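(* There exists a quaternary Hermitian LCD $[n,k,d]$ code for each of the following $(n,k,d)$: $(14,10,3)$, $(15,11,3)$, $(16,12,3)$, $(17,13,3)$, $(26,4,17)$, $(26,17,6)$, $(26,19,5)$, $(26,20,4)$, $(27,18,6)$, $(27,19,5)$, $(27,20,5)$, $(27,21,4)$, $(28,5,17)$, $(28,17,7)$, $(28,19,6)$, $(28,20,5)$, $(28,21,5)$, $(28,22,4)$, $(29,5,18)$, $(29,6,17)$, $(29,18,7)$, $(29,20,6)$, $(29,21,5)$, $(29,22,5)$, $(29,23,4)$, $(30,5,19)$, $(30,16,9)$, $(30,19,7)$, $(30,21,6)$, $(30,22,5)$, $(30,23,5)$; and $(26,6,14)$, $(26,7,13)$, $(26,8,12)$, $(26,12,9)$, $(26,14,7)$, $(26,15,7)$, $(26,16,6)$, $(27,4,17)$, $(27,7,14)$, $(27,10,11)$, $(27,13,9)$, $(27,14,8)$, $(27,15,7)$, $(27,16,7)$, $(27,17,6)$, $(28,7,14)$, $(28,8,14)$, $(28,10,12)$, $(28,14,9)$, $(28,15,8)$, $(28,16,7)$, $(28,18,6)$, $(29,4,18)$, $(29,7,15)$, $(29,8,14)$, $(29,9,14)$, $(29,10,13)$, $(29,15,9)$, $(29,16,8)$, $(29,17,7)$, $(29,19,6)$, $(30,4,19)$, $(30,6,17)$, $(30,8,15)$, $(30,9,14)$, $(30,10,14)$, $(30,17,8)$, $(30,18,7)$, $(30,20,6)$.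
   Context: A quaternary $[n,k]$ code is a $k$-dimensional subspace $C$ of $\mathbb{F}_4^n$. The minimum weight of $C$ is the smallest number of nonzero coordinates of a nonzero codeword; an $[n,k,d]$ code is an $[n,k]$ code with minimum weight $d$. For $a\in\mathbb{F}_4$, $\overline{a}=a^2$. The Hermitian inner product of $u,v\in\mathbb{F}_4^n$ is $(u,v)_h=\sum_{j=1}^n u_j\overline{v_j}$, and $C^{\perp h}=\{u\in\mathbb{F}_4^n\mid (u,v)_h=0\text{ for all }v\in C\}$. $C$ is a Hermitian LCD code if $C\cap C^{\perp h}=\{0\}$. *)

theory Defs
  imports "Jordan_Normal_Form.VS_Connect"
begin

text \<open>
  The field with four elements. The constructors stand for \<open>0, 1, \<omega>, \<omega>\<^sup>2\<close>,
  where \<open>\<omega>\<^sup>2 = \<omega> + 1\<close>.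
\<close>

datatype gf4 = F0 | F1 | Fw | Fw2

lemma UNIV_gf4: "UNIV = {F0, F1, Fw, Fw2}"
  by (auto intro: gf4.exhaust)

lemma card_gf4: "card (UNIV :: gf4 set) = 4"
  by (simp add: UNIV_gf4)

instance gf4 :: finite
  by standard (simp add: UNIV_gf4)

instantiation gf4 :: field
begin

definition zero_gf4 :: gf4 where "0 = F0"

definition one_gf4 :: gf4 where "1 = F1"

fun plus_gf4 :: "gf4 \<Rightarrow> gf4 \<Rightarrow> gf4" where
  "F0 + y = y"
| "x + F0 = x"
| "F1 + F1 = F0"
| "F1 + Fw = Fw2"
| "F1 + Fw2 = Fw"
| "Fw + F1 = Fw2"
| "Fw + Fw = F0"
| "Fw + Fw2 = F1"
| "Fw2 + F1 = Fw"
| "Fw2 + Fw = F1"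
| "Fw2 + Fw2 = F0"

fun times_gf4 :: "gf4 \<Rightarrow> gf4 \<Rightarrow> gf4" where
  "F0 * y = F0"
| "x * F0 = F0"
| "F1 * y = y"
| "x * F1 = x"
| "Fw * Fw = Fw2"
| "Fw * Fw2 = F1"
| "Fw2 * Fw = F1"
| "Fw2 * Fw2 = Fw"

definition uminus_gf4 :: "gf4 \<Rightarrow> gf4" where "- x = (x :: gf4)"

definition minus_gf4 :: "gf4 \<Rightarrow> gf4 \<Rightarrow> gf4" where "x - y = x + (y :: gf4)"

fun inverse_gf4 :: "gf4 \<Rightarrow> gf4" where
  "inverse F0 = F0"
| "inverse F1 = F1"
| "inverse Fw = Fw2"
| "inverse Fw2 = Fw"

definition divide_gf4 :: "gf4 \<Rightarrow> gf4 \<Rightarrow> gf4" where "x div y = x * inverse (y :: gf4)"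

instance
proof
  fix a b c :: gf4
  show "a * b * c = a * (b * c)" by (cases a; cases b; cases c; simp)
  show "a * b = b * a" by (cases a; cases b; simp)
  show "1 * a = a" by (cases a; simp add: one_gf4_def)
  show "a + b + c = a + (b + c)" by (cases a; cases b; cases c; simp)
  show "a + b = b + a" by (cases a; cases b; simp)
  show "0 + a = a" by (simp add: zero_gf4_def)
  show "- a + a = 0" by (cases a; simp add: zero_gf4_def uminus_gf4_def)
  show "a - b = a + - b" by (simp add: minus_gf4_def uminus_gf4_def)
  show "(a + b) * c = a * c + b * c" by (cases a; cases b; cases c; simp)
  show "(0 :: gf4) \<noteq> 1" by (simp add: zero_gf4_def one_gf4_def)
  show "a \<noteq> 0 \<Longrightarrow> inverse a * a = 1"
    by (cases a; simp add: zero_gf4_def one_gf4_def)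
  show "a div b = a * inverse b" by (simp add: divide_gf4_def)
  show "inverse (0 :: gf4) = 0" by (simp add: zero_gf4_def)
qed

end

text \<open>
  With this conjugation, the library's \<open>u \<bullet>c v = u \<bullet> conjugate v\<close> is the Hermitian
  inner product \<open>\<Sum>j. u\<^sub>j * (v\<^sub>j)\<^sup>2\<close>.
\<close>

instantiation gf4 :: conjugatable_field
begin

definition conjugate_gf4 :: "gf4 \<Rightarrow> gf4" where "conjugate a = (a :: gf4) ^ 2"

instance
proof
  fix a b :: gf4
  show "conjugate (conjugate a) = a"
    by (cases a; simp add: conjugate_gf4_def power2_eq_square)
  show "conjugate a = conjugate b \<longleftrightarrow> a = b"
    by (cases a; cases b; simp add: conjugate_gf4_def power2_eq_square)
  show "conjugate (a * b) = conjugate a * conjugate b"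
    by (simp add: conjugate_gf4_def power_mult_distrib)
  show "conjugate (a + b) = conjugate a + conjugate b"
    by (cases a; cases b; simp add: conjugate_gf4_def power2_eq_square)
  show "conjugate (- a) = - conjugate a"
    by (simp add: conjugate_gf4_def uminus_gf4_def)
  show "conjugate (0 :: gf4) = 0"
    by (simp add: conjugate_gf4_def)
qed

end

definition hamming_weight :: "'a :: zero vec \<Rightarrow> nat" where
  "hamming_weight v = card {i. i < dim_vec v \<and> v $ i \<noteq> 0}"

text \<open>Only meaningful for \<open>C \<noteq> {0}\<close>.\<close>

definition min_weight :: "nat \<Rightarrow> 'a :: zero vec set \<Rightarrow> nat" where
  "min_weight n C = (LEAST w. \<exists>c \<in> C. c \<noteq> 0\<^sub>v n \<and> hamming_weight c = w)"

definition quaternary_code :: "nat \<Rightarrow> nat \<Rightarrow> gf4 vec set \<Rightarrow> bool" where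
  "quaternary_code n k C \<longleftrightarrow>
     subspace class_ring C (module_vec TYPE(gf4) n) \<and>
     vectorspace.dim class_ring (module_vec TYPE(gf4) n\<lparr>carrier := C\<rparr>) = k"

definition quaternary_code_dist :: "nat \<Rightarrow> nat \<Rightarrow> nat \<Rightarrow> gf4 vec set \<Rightarrow> bool" where
  "quaternary_code_dist n k d C \<longleftrightarrow> quaternary_code n k C \<and> min_weight n C = d"

definition hermitian_dual :: "nat \<Rightarrow> gf4 vec set \<Rightarrow> gf4 vec set" where
  "hermitian_dual n C = {u \<in> carrier_vec n. \<forall>v \<in> C. u \<bullet>c v = 0}"

definition hermitian_LCD :: "nat \<Rightarrow> gf4 vec set \<Rightarrow> bool" where
  "hermitian_LCD n C \<longleftrightarrow> C \<inter> hermitian_dual n C = {0\<^sub>v n}"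

end

theory Submission
  imports Defs
begin

text \<open>
  All seventy codes come from thirteen explicit codes with generator matrix \<open>[I | A]\<close>, found by a
  computer search, mostly among quasi-cyclic codes. Deleting a row of \<open>A\<close> shortens the code and
  keeps the distance bound; deleting a column punctures it and lowers the bound by one; a zero
  column changes nothing but the length. Since \<open>A\<close> has a row of weight \<open>d - 1\<close>, which is never
  deleted, the bounds are attained. The code is Hermitian LCD iff its Gram matrix
  \<open>I + A A\<^sup>*\<close> is nonsingular, which Gaussian elimination decides.

  That a long code has no nonzero word of weight below \<open>d\<close> cannot be checked word by word. But if
  the code has an automorphism under whose powers the information set is spread evenly over
  the coordinates, then some image of a light word has small weight on the information set, so it
  suffices to enumerate the information words of small weight.
\<close>

section \<open>Words as lists\<close>

lemma gf4_char2: "(x :: gf4) + x = 0"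
  by (cases x) (simp_all add: zero_gf4_def)

lemma gf4_add_eq_0_iff: "(x :: gf4) + y = 0 \<longleftrightarrow> x = y"
  by (cases x; cases y) (simp_all add: zero_gf4_def)

fun vadd :: "gf4 list \<Rightarrow> gf4 list \<Rightarrow> gf4 list" where
  "vadd (x # xs) (y # ys) = (x + y) # vadd xs ys"
| "vadd _ _ = []"

definition vscale :: "gf4 \<Rightarrow> gf4 list \<Rightarrow> gf4 list" where
  "vscale c xs = map ((*) c) xs"

definition wt :: "gf4 list \<Rightarrow> nat" where
  "wt xs = length (filter (\<lambda>x. x \<noteq> 0) xs)"

text \<open>The product of the row vector \<open>u\<close> with the matrix whose rows are
  \<open>A\<close>. The number of columns \<open>r\<close> is passed along because an empty list of
  rows does not determine it.\<close>

fun enc :: "nat \<Rightarrow> gf4 list list \<Rightarrow> gf4 list \<Rightarrow> gf4 list" where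
  "enc r (a # A) (c # u) = vadd (vscale c a) (enc r A u)"
| "enc r _ _ = replicate r 0"

lemma length_vadd [simp]: "length (vadd xs ys) = min (length xs) (length ys)"
  by (induction xs ys rule: vadd.induct) auto

lemma nth_vadd [simp]: "i < length xs \<Longrightarrow> i < length ys \<Longrightarrow> vadd xs ys ! i = xs ! i + ys ! i"
  by (induction xs ys arbitrary: i rule: vadd.induct) (auto simp: nth_Cons split: nat.split)

lemma length_vscale [simp]: "length (vscale c xs) = length xs"
  by (simp add: vscale_def)

lemma nth_vscale [simp]: "i < length xs \<Longrightarrow> vscale c xs ! i = c * xs ! i"
  by (simp add: vscale_def)

lemma length_enc [simp]: "\<forall>a \<in> set A. length a = r \<Longrightarrow> length (enc r A u) = r"
  by (induction r A u rule: enc.induct) auto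

lemma nth_enc:
  assumes "\<forall>a \<in> set A. length a = r" "length u = length A" "j < r"
  shows "enc r A u ! j = (\<Sum>i<length A. u ! i * A ! i ! j)"
  using assms(2,1)
proof (induction u A rule: list_induct2)
  case (Cons c u a A)
  then show ?case
    using assms(3) by (simp add: sum.lessThan_Suc_shift del: sum.lessThan_Suc)
qed (use assms(3) in simp)

lemma enc_vadd:
  assumes "\<forall>a \<in> set A. length a = r" "length u = length A" "length v = length A"
  shows "enc r A (vadd u v) = vadd (enc r A u) (enc r A v)"
  using assms by (intro nth_equalityI) (auto simp: nth_enc distrib_right sum.distrib)

lemma enc_vscale:
  assumes "\<forall>a \<in> set A. length a = r" "length u = length A"
  shows "enc r A (vscale c u) = vscale c (enc r A u)"
  using assms by (intro nth_equalityI) (auto simp: nth_enc sum_distrib_left mult.assoc)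

lemma wt_Cons [simp]: "wt (x # xs) = (if x = 0 then 0 else 1) + wt xs"
  and wt_Nil [simp]: "wt [] = 0"
  and wt_append [simp]: "wt (xs @ ys) = wt xs + wt ys"
  and wt_replicate_0 [simp]: "wt (replicate n 0) = 0"
  by (simp_all add: wt_def)

lemma wt_eq_0_iff: "wt xs = 0 \<longleftrightarrow> xs = replicate (length xs) 0"
  by (induction xs) auto

lemma wt_vscale [simp]: "c \<noteq> 0 \<Longrightarrow> wt (vscale c xs) = wt xs"
  by (induction xs) (auto simp: vscale_def)

lemma wt_conv_card: "wt xs = card {i. i < length xs \<and> xs ! i \<noteq> 0}"
  by (simp add: wt_def length_filter_conv_card)

lemma vscale_0 [simp]: "vscale 0 xs = replicate (length xs) 0"
  by (intro nth_equalityI) auto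

lemma vscale_1 [simp]: "vscale 1 xs = xs"
  by (intro nth_equalityI) auto

lemma vadd_replicate_0:
  assumes "length xs = r"
  shows "vadd (replicate r 0) xs = xs" "vadd xs (replicate r 0) = xs"
  using assms by (auto intro!: nth_equalityI)

lemma vadd_assoc: "vadd (vadd xs ys) zs = vadd xs (vadd ys zs)"
  by (intro nth_equalityI) (auto simp: add.assoc)

lemma enc_wt_0:
  assumes "\<forall>a \<in> set A. length a = r" "length u = length A" "wt u = 0"
  shows "enc r A u = replicate r 0"
proof -
  have "u = vscale 0 u" using assms(3) wt_eq_0_iff by auto
  then have "enc r A u = vscale 0 (enc r A u)"
    using enc_vscale[OF assms(1,2), of 0] by simp
  then show ?thesis using assms(1) by simp
qed

section \<open>Codes with generator matrix [I | A]\<close>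

text \<open>The codewords of [I | A] are \<open>u @ enc r A u\<close>, so the weight splits into an
  information part and a check part.\<close>

definition min_dist_ge :: "nat \<Rightarrow> gf4 list list \<Rightarrow> nat \<Rightarrow> bool" where
  "min_dist_ge r A d \<longleftrightarrow>
     (\<forall>u. length u = length A \<and> wt u > 0 \<longrightarrow> d \<le> wt u + wt (enc r A u))"

section \<open>Shortening, puncturing and zero columns\<close>

lemma enc_drop_rows:
  "\<forall>a \<in> set A. length a = r \<Longrightarrow> s \<le> length A \<Longrightarrow> enc r A (replicate s 0 @ u) = enc r (drop s A) u"
proof (induction s arbitrary: A)
  case (Suc s)
  then obtain a A' where A: "A = a # A'" by (cases A) auto
  with Suc.prems have "length (enc r (drop s A') u) = r"
    by (intro length_enc) (auto dest: in_set_dropD)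
  with Suc A show ?case by (simp add: vadd_replicate_0)
qed simp

text \<open>Padding with \<open>s\<close> zero information symbols turns a word of the shortened
  code into a word of the original code of the same weight.\<close>

lemma min_dist_ge_drop_rows:
  assumes "min_dist_ge r A d" "\<forall>a \<in> set A. length a = r" "s \<le> length A"
  shows "min_dist_ge r (drop s A) d"
  unfolding min_dist_ge_def
proof (intro allI impI, elim conjE)
  fix u assume "length u = length (drop s A)" "wt u > 0"
  then show "d \<le> wt u + wt (enc r (drop s A) u)"
    using assms enc_drop_rows[OF assms(2,3), of u]
    by (auto simp: min_dist_ge_def dest!: spec[of _ "replicate s 0 @ u"])
qed

lemma enc_map_drop:
  assumes "\<forall>a \<in> set A. length a = r" "p \<le> r" "length u = length A"
  shows "enc (r - p) (map (drop p) A) u = drop p (enc r A u)"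
  using assms by (intro nth_equalityI) (auto simp: nth_enc)

lemma wt_drop: "wt xs \<le> p + wt (drop p xs)"
proof -
  have "wt xs = wt (take p xs) + wt (drop p xs)"
    by (metis append_take_drop_id wt_append)
  moreover have "wt (take p xs) \<le> p"
    unfolding wt_def by (rule order_trans[OF length_filter_le]) simp
  ultimately show ?thesis by simp
qed

text \<open>Only check symbols are removed, and \<open>p\<close> of them carry weight at most
  \<open>p\<close>.\<close>

lemma min_dist_ge_drop_cols:
  assumes "min_dist_ge r A d" "\<forall>a \<in> set A. length a = r" "p \<le> r"
  shows "min_dist_ge (r - p) (map (drop p) A) (d - p)"
  unfolding min_dist_ge_def
proof (intro allI impI, elim conjE)
  fix u assume u: "length u = length (map (drop p) A)" "wt u > 0"
  then have "d \<le> wt u + wt (enc r A u)"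
    using assms(1) by (auto simp: min_dist_ge_def)
  with wt_drop[of "enc r A u" p] show "d - p \<le> wt u + wt (enc (r - p) (map (drop p) A) u)"
    using u assms by (simp add: enc_map_drop)
qed

lemma enc_append_zeros:
  assumes "\<forall>a \<in> set A. length a = r" "length u = length A"
  shows "enc (r + z) (map (\<lambda>a. a @ replicate z 0) A) u = enc r A u @ replicate z 0"
  using assms by (intro nth_equalityI) (auto simp: nth_enc nth_append)

lemma min_dist_ge_append_zeros:
  assumes "min_dist_ge r A d" "\<forall>a \<in> set A. length a = r"
  shows "min_dist_ge (r + z) (map (\<lambda>a. a @ replicate z 0) A) d"
  using assms by (auto simp: min_dist_ge_def enc_append_zeros)

definition unit_word :: "nat \<Rightarrow> nat \<Rightarrow> gf4 list" where
  "unit_word k i = (replicate k 0)[i := 1]"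

lemma length_unit_word [simp]: "length (unit_word k i) = k"
  by (simp add: unit_word_def)

lemma nth_unit_word: "j < k \<Longrightarrow> unit_word k i ! j = (if i = j then 1 else 0)"
  by (auto simp: unit_word_def nth_list_update)

lemma wt_unit_word: "i < k \<Longrightarrow> wt (unit_word k i) = 1"
proof -
  assume "i < k"
  then have "{j. j < k \<and> unit_word k i ! j \<noteq> 0} = {i}"
    by (auto simp: nth_unit_word split: if_splits)
  then show ?thesis by (simp add: wt_conv_card)
qed

lemma enc_unit_word:
  assumes "\<forall>a \<in> set A. length a = r" "i < length A"
  shows "enc r A (unit_word (length A) i) = A ! i"
proof (rule nth_equalityI)
  show "length (enc r A (unit_word (length A) i)) = length (A ! i)"
    using assms by simp
  fix j assume "j < length (enc r A (unit_word (length A) i))"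
  then have "j < r" using assms by simp
  then have "enc r A (unit_word (length A) i) ! j = (\<Sum>l<length A. unit_word (length A) i ! l * A ! l ! j)"
    using assms by (simp add: nth_enc)
  also have "\<dots> = (\<Sum>l<length A. if l = i then A ! l ! j else 0)"
    by (intro sum.cong) (auto simp: nth_unit_word)
  also have "\<dots> = A ! i ! j" using assms(2) by simp
  finally show "enc r A (unit_word (length A) i) ! j = A ! i ! j" .
qed

section \<open>Systematic codes as subspaces\<close>

definition word :: "nat \<Rightarrow> gf4 list list \<Rightarrow> gf4 list \<Rightarrow> gf4 list" where
  "word r A u = u @ enc r A u"

definition systematic_code :: "nat \<Rightarrow> gf4 list list \<Rightarrow> gf4 vec set" where
  "systematic_code r A = (\<lambda>u. vec_of_list (word r A (list_of_vec u))) ` carrier_vec (length A)"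

text \<open>An injective linear map has a kernel of dimension 0, so by rank-nullity its image has
  the dimension of the source.\<close>

lemma quaternary_code_image:
  assumes f: "f \<in> carrier_vec k \<rightarrow> carrier_vec n"
    and add: "\<And>u v. u \<in> carrier_vec k \<Longrightarrow> v \<in> carrier_vec k \<Longrightarrow> f (u + v) = f u + f v"
    and smult: "\<And>c u. u \<in> carrier_vec k \<Longrightarrow> f (c \<cdot>\<^sub>v u) = c \<cdot>\<^sub>v f u"
    and inj: "inj_on f (carrier_vec k)"
  shows "quaternary_code n k (f ` carrier_vec k)"
proof -
  interpret V: vec_space "TYPE(gf4)" k .
  interpret W: vec_space "TYPE(gf4)" n .
  have "mod_hom class_ring (module_vec TYPE(gf4) k) (module_vec TYPE(gf4) n) f"
    using f V.module_axioms W.module_axioms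
    by (simp add: mod_hom_def mod_hom_axioms_def LinearCombinations.module_hom_def
        module_vec_simps class_ring_simps add smult)
  then have "linear_map class_ring (module_vec TYPE(gf4) k) (module_vec TYPE(gf4) n) f"
    using V.vectorspace_axioms W.vectorspace_axioms by (simp add: linear_map_def)
  then interpret linear_map class_ring "module_vec TYPE(gf4) k" "module_vec TYPE(gf4) n" f .
  have im: "im = f ` carrier_vec k" by (simp add: im_def module_vec_simps)
  have inj': "inj_on f (carrier (module_vec TYPE(gf4) k))"
    using inj by (simp add: module_vec_simps)
  have "vectorspace.dim class_ring (module_vec TYPE(gf4) n\<lparr>carrier := im\<rparr>) = k"
    using rank_nullity[OF V.fin_dim] inj_imp_dim_ker0[OF inj'] V.dim_is_n by simp
  then show ?thesis
    using imT_is_subspace unfolding quaternary_code_def im by simp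
qed

lemma length_word [simp]: "\<forall>a \<in> set A. length a = r \<Longrightarrow> length (word r A u) = length u + r"
  by (simp add: word_def)

lemma word_vadd:
  assumes "\<forall>a \<in> set A. length a = r" "length u = length A" "length v = length A"
  shows "word r A (vadd u v) = vadd (word r A u) (word r A v)"
  using assms by (intro nth_equalityI) (auto simp: word_def nth_append enc_vadd)

lemma word_vscale:
  assumes "\<forall>a \<in> set A. length a = r" "length u = length A"
  shows "word r A (vscale c u) = vscale c (word r A u)"
  using assms by (simp add: word_def enc_vscale) (simp add: vscale_def)

lemma wt_word_eq_0_iff:
  assumes "\<forall>a \<in> set A. length a = r" "length u = length A"
  shows "wt (word r A u) = 0 \<longleftrightarrow> wt u = 0"
  using enc_wt_0[OF assms] by (auto simp: word_def)

lemma list_of_vec_add: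
  "dim_vec u = dim_vec v \<Longrightarrow> list_of_vec (u + v) = vadd (list_of_vec u) (list_of_vec v)"
  by (intro nth_equalityI) (auto simp: list_of_vec_index)

lemma list_of_vec_smult: "list_of_vec (c \<cdot>\<^sub>v u) = vscale c (list_of_vec u)"
  by (intro nth_equalityI) (auto simp: list_of_vec_index)

lemma vec_of_list_vadd:
  "length xs = length ys \<Longrightarrow> vec_of_list (vadd xs ys) = vec_of_list xs + vec_of_list ys"
  by (intro eq_vecI) (auto simp: vec_of_list_index)

lemma vec_of_list_vscale: "vec_of_list (vscale c xs) = c \<cdot>\<^sub>v vec_of_list xs"
  by (intro eq_vecI) (auto simp: vec_of_list_index)

lemma hamming_weight_vec_of_list: "hamming_weight (vec_of_list xs) = wt xs"
  by (simp add: hamming_weight_def wt_conv_card vec_of_list_index)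

lemma vec_of_list_eq_0_iff: "vec_of_list xs = 0\<^sub>v (length xs) \<longleftrightarrow> wt xs = 0"
proof -
  have "0\<^sub>v (length xs) = vec_of_list (replicate (length xs) (0 :: gf4))"
    by (intro eq_vecI) (auto simp: vec_of_list_index)
  then show ?thesis
    by (metis list_vec wt_eq_0_iff)
qed

lemma systematic_code_altdef: "systematic_code r A = {vec_of_list (word r A u) | u. length u = length A}"
proof -
  have "vec_of_list (word r A u) \<in> systematic_code r A" if "length u = length A" for u
    unfolding systematic_code_def
    by (rule image_eqI[of _ _ "vec_of_list u"]) (use that in \<open>simp_all add: list_vec carrier_vecI\<close>)
  moreover have "\<exists>u. c = vec_of_list (word r A u) \<and> length u = length A" if "c \<in> systematic_code r A" for c
  proof -
    from that obtain v where "v \<in> carrier_vec (length A)" "c = vec_of_list (word r A (list_of_vec v))"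
      unfolding systematic_code_def by blast
    then show ?thesis by (intro exI[of _ "list_of_vec v"]) simp
  qed
  ultimately show ?thesis by auto
qed

lemma quaternary_code_systematic:
  assumes "\<forall>a \<in> set A. length a = r"
  shows "quaternary_code (length A + r) (length A) (systematic_code r A)"
  unfolding systematic_code_def
proof (rule quaternary_code_image)
  \<comment> \<open>The first \<open>length A\<close> symbols of a codeword are the information word
    itself.\<close>
  show "inj_on (\<lambda>u. vec_of_list (word r A (list_of_vec u))) (carrier_vec (length A))"
  proof (rule inj_onI)
    fix u v :: "gf4 vec"
    assume *: "u \<in> carrier_vec (length A)" "v \<in> carrier_vec (length A)"
      "vec_of_list (word r A (list_of_vec u)) = vec_of_list (word r A (list_of_vec v))"
    then have "word r A (list_of_vec u) = word r A (list_of_vec v)"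
      by (metis list_vec)
    with * have "list_of_vec u = list_of_vec v"
      by (simp add: word_def)
    then show "u = v" by (metis vec_list)
  qed
next
  fix u v :: "gf4 vec" and c
  assume u: "u \<in> carrier_vec (length A)" and v: "v \<in> carrier_vec (length A)"
  have "word r A (list_of_vec (u + v)) = vadd (word r A (list_of_vec u)) (word r A (list_of_vec v))"
    using word_vadd[OF assms, of "list_of_vec u" "list_of_vec v"] list_of_vec_add[of u v] u v by simp
  then show "vec_of_list (word r A (list_of_vec (u + v))) =
      vec_of_list (word r A (list_of_vec u)) + vec_of_list (word r A (list_of_vec v))"
    using vec_of_list_vadd[of "word r A (list_of_vec u)" "word r A (list_of_vec v)"] u v assms by simp
  show "vec_of_list (word r A (list_of_vec (c \<cdot>\<^sub>v u))) = c \<cdot>\<^sub>v vec_of_list (word r A (list_of_vec u))"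
    using word_vscale[OF assms, of "list_of_vec u" c] u
    by (simp only: list_of_vec_smult vec_of_list_vscale carrier_vecD length_list_of_vec)
next
  show "(\<lambda>u. vec_of_list (word r A (list_of_vec u)))
      \<in> carrier_vec (length A) \<rightarrow> carrier_vec (length A + r)"
    using assms by (intro funcsetI carrier_vecI) simp
qed

text \<open>Row \<open>i\<close> of [I | A] is a codeword of weight \<open>wt (A ! i) + 1\<close>,
  so the lower bound \<open>d\<close> is attained.\<close>

lemma min_weight_systematic:
  assumes A: "\<forall>a \<in> set A. length a = r" and "min_dist_ge r A d"
    and "i < length A" "wt (A ! i) + 1 = d"
  shows "min_weight (length A + r) (systematic_code r A) = d"
  unfolding min_weight_def
proof (rule Least_equality)
  let ?u = "unit_word (length A) i"
  have "wt (word r A ?u) = d"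
    using assms by (simp add: word_def enc_unit_word wt_unit_word)
  then show "\<exists>c\<in>systematic_code r A. c \<noteq> 0\<^sub>v (length A + r) \<and> hamming_weight c = d"
    using vec_of_list_eq_0_iff[of "word r A ?u"] A \<open>wt (A ! i) + 1 = d\<close>
    by (intro bexI[of _ "vec_of_list (word r A ?u)"])
      (auto simp: hamming_weight_vec_of_list systematic_code_altdef)
next
  fix w assume "\<exists>c\<in>systematic_code r A. c \<noteq> 0\<^sub>v (length A + r) \<and> hamming_weight c = w"
  then obtain u where u: "length u = length A" "wt (word r A u) = w"
    "vec_of_list (word r A u) \<noteq> 0\<^sub>v (length A + r)"
    by (auto simp: systematic_code_altdef hamming_weight_vec_of_list)
  have "wt u > 0"
    using u A vec_of_list_eq_0_iff[of "word r A u"] wt_word_eq_0_iff[OF A u(1)] by simp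
  with u assms show "d \<le> w" by (auto simp: min_dist_ge_def word_def)
qed

section \<open>The Gram matrix\<close>

text \<open>The conjugate of \<open>y\<close> is \<open>y * y\<close>, so this is the Hermitian
  inner product on lists.\<close>

fun hdot :: "gf4 list \<Rightarrow> gf4 list \<Rightarrow> gf4" where
  "hdot (x # xs) (y # ys) = x * (y * y) + hdot xs ys"
| "hdot _ _ = 0"

definition add_at :: "nat \<Rightarrow> gf4 list \<Rightarrow> gf4 list" where
  "add_at i xs = xs[i := xs ! i + 1]"

text \<open>The Gram matrix of the rows of [I | A]; \<open>add_at\<close> contributes the diagonal
  of I.\<close>

definition gram :: "gf4 list list \<Rightarrow> gf4 list list" where
  "gram A = map2 (\<lambda>i a. add_at i (map (hdot a) A)) [0..<length A] A"

lemma hdot_conv_sum: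
  "length xs = length ys \<Longrightarrow> hdot xs ys = (\<Sum>j<length xs. xs ! j * conjugate (ys ! j))"
  by (induction xs ys rule: list_induct2)
    (simp_all add: sum.lessThan_Suc_shift conjugate_gf4_def power2_eq_square del: sum.lessThan_Suc)

lemma length_gram [simp]: "length (gram A) = length A"
  by (simp add: gram_def)

lemma length_gram_row: "\<forall>g \<in> set (gram A). length g = length A"
  by (auto simp: gram_def add_at_def set_zip)

lemma nth_gram:
  "i < length A \<Longrightarrow> j < length A \<Longrightarrow>
    gram A ! i ! j = (if i = j then 1 else 0) + hdot (A ! i) (A ! j)"
  by (auto simp: gram_def add_at_def nth_list_update add.commute)

text \<open>The right factor is row \<open>i\<close> of [I | A]. By linearity in the first argument,
  the products of a codeword with all these rows form \<open>u\<close> times the Gram matrix, so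
  orthogonality to the code becomes a linear system in \<open>u\<close>.\<close>

lemma hdot_word_unit:
  assumes A: "\<forall>a \<in> set A. length a = r" and u: "length u = length A" and i: "i < length A"
  shows "hdot (word r A u) (word r A (unit_word (length A) i)) = enc (length A) (gram A) u ! i"
proof -
  let ?k = "length A"
  have app: "hdot (xs @ ys) (xs' @ ys') = hdot xs xs' + hdot ys ys'"
    if "length xs = length xs'" for xs ys xs' ys'
    using that by (induction xs xs' rule: list_induct2) (simp_all add: add.assoc)
  have "hdot u (unit_word ?k i) = (\<Sum>l<?k. u ! l * (if l = i then 1 else 0))"
    using u i by (auto simp: hdot_conv_sum nth_unit_word conjugate_gf4_def intro!: sum.cong)
  moreover have "hdot (enc r A u) (A ! i) = (\<Sum>j<r. \<Sum>l<?k. u ! l * A ! l ! j * conjugate (A ! i ! j))"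
    using assms by (simp add: hdot_conv_sum nth_enc sum_distrib_right)
  moreover have "\<dots> = (\<Sum>l<?k. u ! l * (\<Sum>j<r. A ! l ! j * conjugate (A ! i ! j)))"
    by (subst sum.swap) (simp add: sum_distrib_left mult.assoc)
  moreover have "\<dots> = (\<Sum>l<?k. u ! l * hdot (A ! l) (A ! i))"
    using assms by (intro sum.cong) (auto simp: hdot_conv_sum)
  ultimately have "hdot (word r A u) (word r A (unit_word ?k i)) =
      (\<Sum>l<?k. u ! l * ((if l = i then 1 else 0) + hdot (A ! l) (A ! i)))"
    using assms by (simp add: word_def app enc_unit_word distrib_left sum.distrib)
  also have "\<dots> = enc ?k (gram A) u ! i"
    using assms length_gram_row[of A] by (simp add: nth_enc nth_gram)
  finally show ?thesis .
qed

section \<open>Gaussian elimination over the field with four elements\<close>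

text \<open>The \<open>c\<close> for which \<open>s + c r\<close> vanishes at the first nonzero position of \<open>r\<close>.\<close>

fun coef :: "gf4 list \<Rightarrow> gf4 list \<Rightarrow> gf4" where
  "coef (F0 # r) (y # s) = coef r s"
| "coef (x # r) (y # s) = y * inverse x"
| "coef _ _ = 0"

definition elim_row :: "gf4 list \<Rightarrow> gf4 list \<Rightarrow> gf4 list" where
  "elim_row r s = vadd s (vscale (coef r s) r)"

text \<open>Forward elimination without row exchanges: each row chooses its own pivot column, its
  first nonzero position, and a zero row reveals a dependency. The recursive call is on a mapped
  list, hence the measure \<open>length\<close>.\<close>

function (sequential) rows_indep :: "gf4 list list \<Rightarrow> bool" where
  "rows_indep [] = True"
| "rows_indep (r # M) = (wt r \<noteq> 0 \<and> rows_indep (map (elim_row r) M))"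
  by pat_completeness auto
termination by (relation "measure length") auto

text \<open>The pivot position depends on \<open>r\<close> only, so a single \<open>p\<close> serves
  all rows \<open>s\<close>.\<close>

lemma coef_pivot:
  "wt r \<noteq> 0 \<Longrightarrow>
    \<exists>p<length r. r ! p \<noteq> 0 \<and> (\<forall>s. length s = length r \<longrightarrow> coef r s = s ! p * inverse (r ! p))"
proof (induction r)
  case (Cons x r)
  show ?case
  proof (cases "x = 0")
    case True
    with Cons obtain p where p: "p < length r" "r ! p \<noteq> 0"
      "\<forall>s. length s = length r \<longrightarrow> coef r s = s ! p * inverse (r ! p)"
      by auto
    have "coef (x # r) s = s ! Suc p * inverse (r ! p)" if "length s = Suc (length r)" for s
      using p(3) True that by (cases s) (simp_all add: zero_gf4_def)
    with p show ?thesis by (intro exI[of _ "Suc p"]) simp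
  next
    case False
    then have "coef (x # r) s = s ! 0 * inverse x" if "length s = Suc (length r)" for s
      using that by (cases s; cases x) (simp_all add: zero_gf4_def)
    with False show ?thesis by (intro exI[of _ 0]) simp
  qed
qed simp

text \<open>Each row changes by a multiple of \<open>r\<close>, and these multiples sum up to one
  coefficient \<open>c\<close>. That \<open>c\<close> vanishes with \<open>u\<close> finally yields
  the zero coefficient of the pivot row in \<open>rows_indep_sound\<close>.\<close>

lemma enc_elim_row:
  assumes "\<forall>s \<in> set M. length s = n" "length r = n" "length u = length M"
  shows "\<exists>c. enc n (map (elim_row r) M) u = vadd (vscale c r) (enc n M u) \<and> (wt u = 0 \<longrightarrow> c = 0)"
proof (intro exI conjI)
  let ?c = "\<Sum>i<length M. u ! i * coef r (M ! i)"
  show "enc n (map (elim_row r) M) u = vadd (vscale ?c r) (enc n M u)"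
    using assms by (intro nth_equalityI)
      (auto simp: nth_enc elim_row_def algebra_simps sum.distrib sum_distrib_left)
  show "wt u = 0 \<longrightarrow> ?c = 0"
    using assms(3) by (metis (no_types, lifting) lessThan_iff mult_zero_left nth_replicate sum.neutral wt_eq_0_iff)
qed

text \<open>Let \<open>c r + v M = 0\<close>. Elimination turns \<open>v M\<close> into
  \<open>c' r + v M\<close>, whose pivot entry is 0; comparing pivot entries gives
  \<open>c = c'\<close>, so the eliminated combination vanishes as well. By induction
  \<open>v\<close> is zero, then so is \<open>c'\<close>, and hence \<open>c\<close>.\<close>

lemma rows_indep_sound:
  assumes "rows_indep M" "\<forall>s \<in> set M. length s = n" "length u = length M" "wt (enc n M u) = 0"
  shows "wt u = 0"
  using assms
proof (induction M arbitrary: u rule: rows_indep.induct)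
  case (2 r M)
  then obtain c v where u: "u = c # v" "length v = length M"
    by (cases u) auto
  let ?M = "map (elim_row r) M"
  have len: "length r = n" "\<forall>s \<in> set M. length s = n" "\<forall>s \<in> set ?M. length s = n"
    using 2(3) by (auto simp: elim_row_def)
  have "wt r \<noteq> 0" using 2(2) by simp
  from coef_pivot[OF this, unfolded len(1)] obtain p where p: "p < n" "r ! p \<noteq> 0"
    "\<forall>s. length s = n \<longrightarrow> coef r s = s ! p * inverse (r ! p)"
    by (elim exE conjE) (rule that)
  obtain c' where c': "enc n ?M v = vadd (vscale c' r) (enc n M v)" "wt v = 0 \<longrightarrow> c' = 0"
    using enc_elim_row[OF len(2,1) u(2)] by (elim exE conjE) (rule that)
  have zero: "c * r ! j + enc n M v ! j = 0" if "j < n" for j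
  proof -
    have "enc n (r # M) u ! j = 0"
      using 2(5) that wt_eq_0_iff[of "enc n (r # M) u"] 2(3) by (metis length_enc nth_replicate)
    with that u len show ?thesis by simp
  qed
  \<comment> \<open>\<open>coef\<close> makes the two terms at the pivot equal, and they cancel in
    characteristic 2.\<close>
  have "s ! p = 0" if s: "s \<in> set ?M" for s
  proof -
    obtain t where "t \<in> set M" "s = elim_row r t" using s by auto
    with len p show ?thesis by (simp add: elim_row_def gf4_char2 mult.assoc)
  qed
  then have "enc n ?M v ! p = 0"
    using u len p by (subst nth_enc) auto
  with c' len p have "c' * r ! p + enc n M v ! p = 0" by simp
  with zero[OF p(1)] have "c * r ! p = c' * r ! p"
    by (metis gf4_add_eq_0_iff)
  with p have "c = c'" by simp
  with c' zero len have "enc n ?M v = replicate n 0"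
    by (intro nth_equalityI) auto
  then have "wt (enc n ?M v) = 0" by simp
  moreover have "rows_indep ?M" "length v = length ?M" using 2(2) u by auto
  ultimately have "wt v = 0" using 2(1) 2(2) len by simp
  with c' \<open>c = c'\<close> u show ?case by simp
qed simp

text \<open>A codeword in the Hermitian dual is orthogonal to every row of [I | A], so its
  information word times the Gram matrix is zero. Independence of the Gram rows then forces it to
  vanish.\<close>

lemma hermitian_LCD_systematic:
  assumes A: "\<forall>a \<in> set A. length a = r" and "rows_indep (gram A)"
  shows "hermitian_LCD (length A + r) (systematic_code r A)"
proof -
  let ?n = "length A + r"
  have cscalar: "vec_of_list xs \<bullet>c vec_of_list ys = hdot xs ys" if "length xs = length ys" for xs ys
    using that by (simp add: scalar_prod_def hdot_conv_sum vec_of_list_index atLeast0LessThan)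
  have zero: "0\<^sub>v ?n \<in> systematic_code r A"
    using vec_of_list_eq_0_iff[of "word r A (replicate (length A) 0)"] A
      wt_word_eq_0_iff[OF A, of "replicate (length A) 0"]
    unfolding systematic_code_altdef by (auto intro!: exI[of _ "replicate (length A) 0"])
  have "c = 0\<^sub>v ?n" if c: "c \<in> systematic_code r A" "c \<in> hermitian_dual ?n (systematic_code r A)" for c
  proof -
    obtain u where u: "length u = length A" "c = vec_of_list (word r A u)"
      using c(1) by (auto simp: systematic_code_altdef)
    have "enc (length A) (gram A) u ! i = 0" if i: "i < length A" for i
    proof -
      have "vec_of_list (word r A (unit_word (length A) i)) \<in> systematic_code r A"
        by (auto simp: systematic_code_altdef)
      with c(2) u A have "hdot (word r A u) (word r A (unit_word (length A) i)) = 0"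
        by (auto simp: hermitian_dual_def cscalar[symmetric])
      with hdot_word_unit[OF A u(1) i] show ?thesis by simp
    qed
    then have "enc (length A) (gram A) u = replicate (length A) 0"
      using length_gram_row by (intro nth_equalityI) auto
    then have "wt u = 0"
      using rows_indep_sound[OF assms(2) length_gram_row] u(1) by simp
    then show ?thesis
      using vec_of_list_eq_0_iff[of "word r A u"] wt_word_eq_0_iff[OF A u(1)] A u by simp
  qed
  then have "systematic_code r A \<inter> hermitian_dual ?n (systematic_code r A) \<subseteq> {0\<^sub>v ?n}" by blast
  moreover have "v \<in> carrier_vec ?n" if "v \<in> systematic_code r A" for v
    using that A by (auto simp: systematic_code_altdef intro!: carrier_vecI)
  then have "0\<^sub>v ?n \<in> hermitian_dual ?n (systematic_code r A)"
    by (simp add: hermitian_dual_def)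
  ultimately show ?thesis
    unfolding hermitian_LCD_def using zero by blast
qed

section \<open>Enumeration of low-weight information words\<close>

text \<open>\<open>differ m xs ys\<close> decides \<open>m \<le> wt (xs + ys)\<close>; the case split makes each position cost one
  rewrite step.\<close>

fun differ :: "nat \<Rightarrow> gf4 list \<Rightarrow> gf4 list \<Rightarrow> bool" where
  "differ 0 xs ys = True"
| "differ (Suc m) (F0 # xs) (F0 # ys) = differ (Suc m) xs ys"
| "differ (Suc m) (F1 # xs) (F1 # ys) = differ (Suc m) xs ys"
| "differ (Suc m) (Fw # xs) (Fw # ys) = differ (Suc m) xs ys"
| "differ (Suc m) (Fw2 # xs) (Fw2 # ys) = differ (Suc m) xs ys"
| "differ (Suc m) (x # xs) (y # ys) = differ m xs ys"
| "differ (Suc m) xs ys = False"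

text \<open>Here \<open>v\<close> is the check part of a partial word, to which at most \<open>a\<close> multiples of further rows
  are added, and \<open>m\<close> is the weight still missing. The triples hold the three nonzero multiples of
  each row, so that no scaling happens during the enumeration.\<close>

fun extend :: "nat \<Rightarrow> nat \<Rightarrow> gf4 list \<Rightarrow> (gf4 list \<times> gf4 list \<times> gf4 list) list \<Rightarrow> bool" where
  "extend (Suc 0) (Suc m) v ((x, y, z) # B) =
    (differ m v x \<and> differ m v y \<and> differ m v z \<and> extend (Suc 0) (Suc m) v B)"
| "extend (Suc (Suc a)) (Suc m) v ((x, y, z) # B) =
    (differ m v x \<and> differ m v y \<and> differ m v z \<and>
     extend (Suc a) m (vadd v x) B \<and> extend (Suc a) m (vadd v y) B \<and>
     extend (Suc a) m (vadd v z) B \<and> extend (Suc (Suc a)) (Suc m) v B)"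
| "extend _ _ _ _ = True"

definition multiples :: "gf4 list \<Rightarrow> gf4 list \<times> gf4 list \<times> gf4 list" where
  "multiples a = (a, vscale Fw a, vscale Fw2 a)"

text \<open>The row \<open>v\<close> is the first one used, with coefficient 1. Its information
  symbol accounts for one unit of the row budget and one of the distance, leaving \<open>a\<close>
  further rows and missing weight \<open>d\<close>.\<close>

fun low_weight :: "nat \<Rightarrow> nat \<Rightarrow> gf4 list list \<Rightarrow> bool" where
  "low_weight (Suc a) (Suc d) (v # A) =
    (d \<le> wt v \<and> extend a d v (map multiples A) \<and> low_weight (Suc a) (Suc d) A)"
| "low_weight _ _ _ = True"

lemma differ_Cons: "differ m (x # xs) (y # ys) \<longleftrightarrow>
    m = 0 \<or> (if x = y then differ m xs ys else differ (m - 1) xs ys)"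
  by (cases m; cases x; cases y) simp_all

lemma differ_sound: "length xs = length ys \<Longrightarrow> differ m xs ys \<Longrightarrow> m \<le> wt (vadd xs ys)"
proof (induction xs ys arbitrary: m rule: list_induct2)
  case Nil
  then show ?case by (cases m) auto
next
  case (Cons x xs y ys)
  from Cons.prems Cons.IH[of m] Cons.IH[of "m - 1"] show ?case
    by (auto simp: differ_Cons gf4_add_eq_0_iff split: if_splits)
qed

text \<open>Merges the equations of \<open>extend\<close> for one and for several remaining rows,
  and replaces the three stored multiples by an arbitrary nonzero scalar.\<close>

lemma extend_Cons:
  assumes "extend (Suc a) (Suc m) v (map multiples (r # A))"
  shows "extend (Suc a) (Suc m) v (map multiples A)"
    and "c \<noteq> 0 \<Longrightarrow> differ m v (vscale c r)"
    and "c \<noteq> 0 \<Longrightarrow> a > 0 \<Longrightarrow> extend a m (vadd v (vscale c r)) (map multiples A)"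
proof -
  have one: "vscale F1 r = r" using vscale_1[of r] by (simp add: one_gf4_def)
  show "extend (Suc a) (Suc m) v (map multiples A)"
    using assms by (cases a) (simp_all add: multiples_def)
  show "differ m v (vscale c r)" if "c \<noteq> 0"
    using assms that one by (cases a; cases c) (simp_all add: multiples_def zero_gf4_def)
  show "extend a m (vadd v (vscale c r)) (map multiples A)" if "c \<noteq> 0" "a > 0"
    using assms that one by (cases a; cases c) (simp_all add: multiples_def zero_gf4_def)
qed

text \<open>Induction over the rows, by the coefficient \<open>c\<close> of the first. If
  \<open>c\<close> is 0 the row is skipped; if it is the only nonzero one, \<open>differ\<close>
  gives the bound; otherwise the multiple of the row joins \<open>v\<close>, and the symbol
  \<open>c\<close> lowers both the budget and the missing weight by one.\<close>

lemma extend_sound: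
  assumes "extend a m v (map multiples A)" "\<forall>x \<in> set A. length x = r" "length v = r"
    "length u = length A" "0 < wt u" "wt u \<le> a"
  shows "m \<le> wt u + wt (vadd v (enc r A u))"
  using assms
proof (induction A arbitrary: a m v u)
  case (Cons x A)
  obtain c w where u: "u = c # w" "length w = length A"
    using Cons.prems(4) by (cases u) auto
  obtain b where a: "a = Suc b" using Cons.prems(5,6) by (cases a) auto
  show ?case
  proof (cases m)
    case (Suc n)
    note ext = extend_Cons[OF Cons.prems(1)[unfolded a Suc]]
    have len: "length x = r" "length (enc r A w) = r" "\<forall>x \<in> set A. length x = r"
      using Cons.prems(2) by auto
    show ?thesis
    proof (cases "c = 0")
      case True
      with Cons.IH[OF ext(1) len(3) Cons.prems(3) u(2)] Cons.prems a Suc u len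
      show ?thesis by (simp add: vadd_replicate_0)
    next
      case False
      have eq: "vadd v (enc r (x # A) u) = vadd (vadd v (vscale c x)) (enc r A w)"
        using u by (simp add: vadd_assoc)
      show ?thesis
      proof (cases "wt w = 0")
        case True
        then have "enc r A w = replicate r 0" using enc_wt_0[OF len(3) u(2)] by simp
        then have "vadd v (enc r (x # A) u) = vadd v (vscale c x)"
          using eq len Cons.prems(3) by (simp add: vadd_replicate_0)
        with differ_sound[OF _ ext(2)[OF False]] len Cons.prems(3) Suc u False
        show ?thesis by simp
      next
        case nz: False
        with Cons.prems(6) u False a have "b > 0" "wt w \<le> b" by auto
        with Cons.IH[OF ext(3)[OF False \<open>b > 0\<close>] len(3) _ u(2)] nz len Cons.prems(3)
        have "n \<le> wt w + wt (vadd (vadd v (vscale c x)) (enc r A w))" by simp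
        with eq u False Suc show ?thesis by simp
      qed
    qed
  qed simp
qed simp

text \<open>By homogeneity only information words with leading coefficient 1 need to be enumerated.\<close>

lemma low_weight_sound:
  assumes "low_weight a d A" "\<forall>x \<in> set A. length x = r"
    "length u = length A" "0 < wt u" "wt u \<le> a"
  shows "d \<le> wt u + wt (enc r A u)"
  using assms
proof (induction A arbitrary: u)
  case (Cons x A)
  obtain c w where u: "u = c # w" "length w = length A"
    using Cons.prems(3) by (cases u) auto
  obtain b where a: "a = Suc b" using Cons.prems(4,5) by (cases a) auto
  show ?case
  proof (cases d)
    case (Suc e)
    have len: "length x = r" "\<forall>x \<in> set A. length x = r" "length (enc r A w) = r"
      using Cons.prems(2) by auto
    have low: "e \<le> wt x" "extend b e x (map multiples A)" "low_weight a d A"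
      using Cons.prems(1) by (simp_all add: a Suc)
    show ?thesis
    proof (cases "c = 0")
      case True
      with Cons.IH[OF low(3) len(2) u(2)] Cons.prems(4,5) u len
      show ?thesis by (simp add: vadd_replicate_0)
    next
      case False
      define w' where "w' = vscale (inverse c) w"
      have w': "length w' = length A" "wt w' = wt w"
        using u False by (simp_all add: w'_def)
      have "w = vscale c w'"
        using False by (auto simp: w'_def intro!: nth_equalityI)
      then have "enc r A w = vscale c (enc r A w')"
        using enc_vscale[OF len(2) w'(1), of c] by simp
      then have "enc r (x # A) u = vscale c (vadd x (enc r A w'))"
        using u len by (auto intro!: nth_equalityI simp: distrib_left)
      then have eq: "wt (enc r (x # A) u) = wt (vadd x (enc r A w'))"
        using False by simp
      show ?thesis
      proof (cases "wt w' = 0")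
        case True
        then have "enc r A w' = replicate r 0" using enc_wt_0[OF len(2) w'(1)] by simp
        with eq low(1) u False len Suc show ?thesis by (simp add: vadd_replicate_0)
      next
        case nz: False
        with extend_sound[OF low(2) len(2,1) w'(1)] Cons.prems(5) u a False w'
        have "e \<le> wt w + wt (vadd x (enc r A w'))" by auto
        with eq u False Suc show ?thesis by simp
      qed
    qed
  qed simp
qed simp

text \<open>The last row is the witness for distance \<open>d\<close>: rows are dropped from the
  front, so it survives shortening.\<close>

definition systematic :: "nat \<Rightarrow> nat \<Rightarrow> gf4 list list \<Rightarrow> bool" where
  "systematic r d A \<longleftrightarrow> A \<noteq> [] \<and> list_all (\<lambda>a. length a = r) A \<and> wt (last A) + 1 = d"

lemma systematicD:
  assumes "systematic r d A"
  shows "\<forall>a \<in> set A. length a = r" "A \<noteq> []" "wt (last A) + 1 = d"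
  using assms by (auto simp: systematic_def list_all_iff)

text \<open>An information word beyond the enumeration has weight at least \<open>a + 1\<close>;
  either there is none, or this is already \<open>d\<close> or more.\<close>

lemma min_dist_geI:
  assumes "low_weight a d A" "systematic r d A" "length A \<le> a \<or> d \<le> a + 1"
  shows "min_dist_ge r A d"
  unfolding min_dist_ge_def
proof (intro allI impI, elim conjE)
  fix u assume u: "length u = length A" "0 < wt u"
  have "wt u \<le> length u" by (simp add: wt_def)
  with low_weight_sound[OF assms(1) systematicD(1)[OF assms(2)] u] assms(3) u(1) show "d \<le> wt u + wt (enc r A u)" by linarith
qed

section \<open>Exploiting an automorphism\<close>

definition permute :: "nat list \<Rightarrow> 'a list \<Rightarrow> 'a list" where
  "permute p w = map ((!) w) p"

text \<open>The information set and its images under the first \<open>m\<close> powers of the permutation, concatenated.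
  If no coordinate occurs more than \<open>K\<close> times, then the information weights of the \<open>m\<close> images of a
  word of weight at most \<open>d - 1\<close> add up to at most \<open>K * (d - 1)\<close>.\<close>

fun info_positions :: "nat \<Rightarrow> nat list \<Rightarrow> nat \<Rightarrow> nat list \<Rightarrow> nat list" where
  "info_positions k p 0 q = []"
| "info_positions k p (Suc m) q = take k q @ info_positions k p m (permute p q)"

definition is_word :: "nat \<Rightarrow> gf4 list list \<Rightarrow> gf4 list \<Rightarrow> bool" where
  "is_word r A w \<longleftrightarrow> drop (length A) w = enc r A (take (length A) w)"

definition maps_word :: "nat \<Rightarrow> gf4 list list \<Rightarrow> nat list \<Rightarrow> nat \<Rightarrow> gf4 list \<Rightarrow> bool" where
  "maps_word r A p i a \<longleftrightarrow> is_word r A (permute p (unit_word (length A) i @ a))"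

text \<open>Only the rows of [I | A] are tested; linearity extends this to all codewords in
  \<open>automorphism_word\<close>.\<close>

definition automorphism :: "nat \<Rightarrow> gf4 list list \<Rightarrow> nat list \<Rightarrow> bool" where
  "automorphism r A p \<longleftrightarrow> length p = length A + r \<and> distinct p \<and> list_all (\<lambda>j. j < length A + r) p \<and>
     list_all2 (maps_word r A p) [0..<length A] A"

definition covers_at_most :: "nat \<Rightarrow> nat \<Rightarrow> nat \<Rightarrow> nat list \<Rightarrow> nat \<Rightarrow> bool" where
  "covers_at_most K n k p m \<longleftrightarrow>
     list_all (\<lambda>j. count_list (info_positions k p m [0..<n]) j \<le> K) [0..<n]"

text \<open>\<open>K * (d - 1)\<close> bounds the total information weight of \<open>m\<close>
  images of a light word, and \<open>m * (a + 1)\<close> is the least total if all of them escape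
  the enumeration.\<close>

definition averaging ::
    "nat \<Rightarrow> nat \<Rightarrow> nat \<Rightarrow> gf4 list list \<Rightarrow> nat list \<Rightarrow> nat \<Rightarrow> nat \<Rightarrow> bool" where
  "averaging r d a A p K m \<longleftrightarrow> automorphism r A p \<and>
     covers_at_most K (length A + r) (length A) p m \<and> K * (d - 1) < m * (a + 1)"

lemma length_permute [simp]: "length (permute p w) = length p"
  by (simp add: permute_def)

text \<open>Lets the images of one word be followed through the lists of positions from which they
  are read.\<close>

lemma permute_map_nth:
  "\<forall>j \<in> set p. j < length q \<Longrightarrow> permute p (map f q) = map f (permute p q)"
  by (simp add: permute_def)

lemma wt_permute:
  assumes "length p = length w" "distinct p" "\<forall>j \<in> set p. j < length w"
  shows "wt (permute p w) = wt w"
proof -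
  \<comment> \<open>Distinct indices, as many as there are positions, exhaust the positions.\<close>
  have "set p = {..<length w}"
    using assms by (intro card_subset_eq) (auto simp: distinct_card)
  have "wt (permute p w) = length (filter (\<lambda>j. w ! j \<noteq> 0) p)"
    by (simp add: wt_def permute_def filter_map comp_def)
  also have "\<dots> = card {j \<in> set p. w ! j \<noteq> 0}"
    using assms(2) by (metis distinct_card distinct_filter set_filter)
  also have "\<dots> = wt w"
    using \<open>set p = {..<length w}\<close> by (simp add: wt_conv_card)
  finally show ?thesis .
qed

lemma is_word_iff:
  assumes "length w = length A + r"
  shows "is_word r A w \<longleftrightarrow> (\<exists>u. length u = length A \<and> w = word r A u)"
proof
  assume "is_word r A w"
  then have "word r A (take (length A) w) = take (length A) w @ drop (length A) w"
    by (simp only: is_word_def word_def)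
  then have "w = word r A (take (length A) w)" by simp
  with assms show "\<exists>u. length u = length A \<and> w = word r A u"
    by (intro exI[of _ "take (length A) w"]) simp
qed (auto simp: is_word_def word_def)

text \<open>Presents a codeword as a combination of the rows of [I | A], so that closure properties
  can be applied along the recursion of \<open>enc\<close>.\<close>

lemma word_conv_enc:
  assumes "\<forall>a \<in> set A. length a = r" "length u = length A"
  shows "word r A u = enc (length A + r) (map (\<lambda>i. word r A (unit_word (length A) i)) [0..<length A]) u"
proof (rule nth_equalityI)
  let ?G = "map (\<lambda>i. word r A (unit_word (length A) i)) [0..<length A]"
  have G: "\<forall>g \<in> set ?G. length g = length A + r" using assms(1) by simp
  show "length (word r A u) = length (enc (length A + r) ?G u)"
    using assms G by simp
  fix j assume "j < length (word r A u)"
  then have j: "j < length A + r" using assms by simp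
  have "enc (length A + r) ?G u ! j = (\<Sum>i<length A. u ! i * (unit_word (length A) i @ A ! i) ! j)"
    by (subst nth_enc[OF G _ j]) (simp_all add: assms word_def enc_unit_word)
  also have "\<dots> = word r A u ! j"
  proof (cases "j < length A")
    case True
    then have "(\<Sum>i<length A. u ! i * (unit_word (length A) i @ A ! i) ! j) =
        (\<Sum>i<length A. if i = j then u ! i else 0)"
      by (intro sum.cong) (auto simp: nth_append nth_unit_word)
    with True assms show ?thesis by (simp add: word_def nth_append)
  next
    case False
    with j assms show ?thesis by (simp add: word_def nth_append nth_enc)
  qed
  finally show "word r A u ! j = enc (length A + r) ?G u ! j" by simp
qed

text \<open>The words that \<open>p\<close> sends into the code form a linear space. It contains the
  rows of [I | A] by the test, hence all their combinations.\<close>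

lemma automorphism_word:
  assumes A: "\<forall>a \<in> set A. length a = r" and p: "automorphism r A p" and u: "length u = length A"
  shows "is_word r A (permute p (word r A u))"
proof -
  let ?k = "length A" and ?n = "length A + r"
  have lp: "length p = ?n" "\<forall>j \<in> set p. j < ?n"
    using p by (auto simp: automorphism_def list_all_iff)
  have word: "is_word r A (permute p x) \<longleftrightarrow> (\<exists>u. length u = ?k \<and> permute p x = word r A u)" for x
    using is_word_iff[of "permute p x" A r] lp(1) by simp
  have add: "is_word r A (permute p (vadd x y))"
    if xy: "length x = ?n" "length y = ?n" "is_word r A (permute p x)" "is_word r A (permute p y)" for x y
  proof -
    have eq: "permute p (vadd x y) = vadd (permute p x) (permute p y)"
      using xy(1,2) lp by (intro nth_equalityI) (auto simp: permute_def)
    obtain u where u: "length u = ?k" "permute p x = word r A u" using xy(3) word by blast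
    obtain v where v: "length v = ?k" "permute p y = word r A v" using xy(4) word by blast
    have "permute p (vadd x y) = word r A (vadd u v)"
      using eq word_vadd[OF A u(1) v(1)] u(2) v(2) by simp
    moreover have "length (vadd u v) = ?k" using u v by simp
    ultimately show ?thesis using word by blast
  qed
  have scale: "is_word r A (permute p (vscale c x))"
    if x: "length x = ?n" "is_word r A (permute p x)" for c x
  proof -
    have eq: "permute p (vscale c x) = vscale c (permute p x)"
      using x(1) lp by (intro nth_equalityI) (auto simp: permute_def)
    obtain u where u: "length u = ?k" "permute p x = word r A u" using x(2) word by blast
    have "permute p (vscale c x) = word r A (vscale c u)"
      using eq word_vscale[OF A u(1)] u(2) by simp
    moreover have "length (vscale c u) = ?k" using u by simp
    ultimately show ?thesis using word by blast
  qed
  have zero: "is_word r A (permute p (replicate ?n 0))"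
  proof -
    have "permute p (replicate ?n 0) = replicate ?n (0 :: gf4)"
      using lp by (intro nth_equalityI) (auto simp: permute_def)
    moreover have "enc r A (replicate ?k 0) = replicate r 0"
      using enc_wt_0[OF A] by simp
    ultimately show ?thesis by (simp add: is_word_def)
  qed
  have enc: "is_word r A (permute p (enc ?n G v))"
    if "\<forall>g \<in> set G. length g = ?n \<and> is_word r A (permute p g)" for G v
    using that
  proof (induction "?n" G v rule: enc.induct)
    case (1 a G c v)
    then show ?case by (auto intro!: add scale length_enc)
  qed (simp_all add: zero)
  have "is_word r A (permute p (word r A (unit_word ?k i)))" if "i < ?k" for i
    using p that A by (auto simp: automorphism_def maps_word_def list_all2_conv_all_nth word_def enc_unit_word)
  then show ?thesis
    using A u by (subst word_conv_enc) (auto intro!: enc)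
qed

text \<open>Double counting: each position satisfying \<open>P\<close> contributes at most
  \<open>K\<close> occurrences.\<close>

lemma length_filter_le_count:
  assumes "finite S" "set L \<subseteq> S" "\<forall>j \<in> S. count_list L j \<le> K"
  shows "length (filter P L) \<le> K * card {j \<in> S. P j}"
proof -
  have count: "count_list (filter P L) j \<le> count_list L j" for j
    by (induction L) auto
  have "length (filter P L) = (\<Sum>j \<in> set (filter P L). count_list (filter P L) j)"
    by (simp add: sum_count_set)
  also have "\<dots> \<le> (\<Sum>j \<in> set (filter P L). K)"
    using assms(2,3) by (intro sum_mono order_trans[OF count]) auto
  also have "\<dots> = K * card (set (filter P L))"
    by simp
  also have "\<dots> \<le> K * card {j \<in> S. P j}"
    using assms(1,2) by (intro mult_le_mono2 card_mono) auto
  finally show ?thesis .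
qed

lemma set_info_positions:
  "set p \<subseteq> {..<n} \<Longrightarrow> length q = n \<Longrightarrow> set q \<subseteq> {..<n} \<Longrightarrow> length p = n \<Longrightarrow>
    set (info_positions k p m q) \<subseteq> {..<n}"
proof (induction m arbitrary: q)
  case (Suc m)
  have "q ! j < n" if "j \<in> set p" for j
    using that Suc.prems nth_mem[of j q] by blast
  then have "set (permute p q) \<subseteq> {..<n}"
    by (auto simp: permute_def)
  then have "set (info_positions k p m (permute p q)) \<subseteq> {..<n}"
    using Suc by simp
  with Suc.prems(3) show ?case by (auto dest: in_set_takeD)
qed simp

text \<open>All images of a nonzero word lighter than \<open>d\<close> are again such words, and the
  enumeration forces information weight at least \<open>a + 1\<close> on each. Over \<open>m\<close>
  images this exceeds what at most \<open>d - 1\<close> support positions, each met at most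
  \<open>K\<close> times, can supply.\<close>

lemma min_dist_ge_averaging:
  assumes low: "low_weight a d A" and sys: "systematic r d A" and avg: "averaging r d a A p K m"
  shows "min_dist_ge r A d"
proof (rule ccontr)
  let ?k = "length A" and ?n = "length A + r"
  note A = systematicD(1)[OF sys]
  have aut: "automorphism r A p" and cov: "covers_at_most K ?n ?k p m"
    and less: "K * (d - 1) < m * (a + 1)"
    using avg by (simp_all add: averaging_def)
  define W where "W = {w. \<exists>u. length u = ?k \<and> 0 < wt u \<and> w = word r A u \<and> wt w < d}"
  have p: "length p = ?n" "distinct p" "\<forall>j \<in> set p. j < ?n"
    using aut by (auto simp: automorphism_def list_all_iff)
  have len: "length w = ?n" if "w \<in> W" for w
    using that A by (auto simp: W_def)
  have closed: "permute p w \<in> W" if "w \<in> W" for w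
  proof -
    obtain u where u: "length u = ?k" "0 < wt u" "w = word r A u" "wt w < d"
      using \<open>w \<in> W\<close> by (auto simp: W_def)
    have wt: "wt (permute p w) = wt w"
      using p len[OF \<open>w \<in> W\<close>] by (intro wt_permute) auto
    obtain v where v: "length v = ?k" "permute p w = word r A v"
      using automorphism_word[OF A aut u(1)] is_word_iff[of "permute p w" A r] u(3) p(1) by auto
    have "wt v > 0"
      using wt v u wt_word_eq_0_iff[OF A v(1)] wt_word_eq_0_iff[OF A u(1)] by simp
    with v wt u(4) show ?thesis by (auto simp: W_def)
  qed
  have heavy: "a + 1 \<le> wt (take ?k w)" if "w \<in> W" for w
  proof (rule ccontr)
    obtain u where u: "length u = ?k" "0 < wt u" "w = word r A u" "wt w < d"
      using \<open>w \<in> W\<close> by (auto simp: W_def)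
    assume "\<not> a + 1 \<le> wt (take ?k w)"
    then have "wt u \<le> a" using u by (simp add: word_def)
    with low_weight_sound[OF low A u(1,2)] u(3,4) show False by (simp add: word_def)
  qed
  assume "\<not> min_dist_ge r A d"
  then obtain u where "length u = ?k" "wt u > 0" "wt u + wt (enc r A u) < d"
    by (auto simp: min_dist_ge_def not_le)
  then have "word r A u \<in> W" by (auto simp: W_def word_def)
  then obtain w where w: "w \<in> W" by blast
  \<comment> \<open>Generalized over \<open>q\<close>, the positions of \<open>w\<close> from which
    the current image is read; passing to \<open>permute p q\<close> moves on to the next
    image.\<close>
  have "m * (a + 1) \<le> length (filter (\<lambda>j. w ! j \<noteq> 0) (info_positions ?k p m q))"
    if "length q = ?n" "map ((!) w) q \<in> W" for q
    using that
  proof (induction m arbitrary: q)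
    case (Suc m)
    have "map ((!) w) (permute p q) \<in> W"
      using closed[OF Suc.prems(2)] p Suc.prems(1) by (simp add: permute_map_nth)
    then have "m * (a + 1) \<le> length (filter (\<lambda>j. w ! j \<noteq> 0) (info_positions ?k p m (permute p q)))"
      using Suc.IH[of "permute p q"] p by simp
    moreover have "wt (take ?k (map ((!) w) q)) = length (filter (\<lambda>j. w ! j \<noteq> 0) (take ?k q))"
      by (simp add: wt_def take_map filter_map comp_def)
    ultimately show ?case
      using heavy[OF Suc.prems(2)] by simp
  qed simp
  from this[of "[0..<?n]"] have "m * (a + 1) \<le>
      length (filter (\<lambda>j. w ! j \<noteq> 0) (info_positions ?k p m [0..<?n]))"
    using w len[OF w] by (metis length_upt map_nth minus_nat.diff_0)
  also have "\<dots> \<le> K * card {j \<in> {..<?n}. w ! j \<noteq> 0}"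
    using cov p by (intro length_filter_le_count set_info_positions)
      (auto simp: covers_at_most_def list_all_iff)
  also have "\<dots> = K * wt w"
    using len[OF w] by (simp add: wt_conv_card)
  also have "\<dots> \<le> K * (d - 1)"
    using w by (auto simp: W_def)
  finally show False using less by simp
qed

section \<open>Shortening, puncturing and lengthening\<close>

definition lcd_params :: "nat \<Rightarrow> nat \<Rightarrow> nat \<Rightarrow> bool" where
  "lcd_params n k d \<longleftrightarrow> (\<exists>C. quaternary_code_dist n k d C \<and> hermitian_LCD n C)"

lemma lcd_params_systematic:
  assumes "\<forall>a \<in> set A. length a = r" "min_dist_ge r A d" "i < length A" "wt (A ! i) + 1 = d"
    "rows_indep (gram A)"
  shows "lcd_params (length A + r) (length A) d"
  unfolding lcd_params_def quaternary_code_dist_def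
  using quaternary_code_systematic[OF assms(1)] min_weight_systematic[OF assms(1-4)]
    hermitian_LCD_systematic[OF assms(1,5)] by blast

text \<open>The target parameters determine how many rows and columns to drop; zero columns fill up the
  length to \<open>n'\<close>.\<close>

fun derivable :: "nat \<Rightarrow> nat \<Rightarrow> gf4 list list \<Rightarrow> nat \<times> nat \<times> nat \<Rightarrow> bool" where
  "derivable r d A (n', k', d') \<longleftrightarrow>
     0 < k' \<and> k' \<le> length A \<and> d' \<le> d \<and> d - d' \<le> r \<and> k' + (r - (d - d')) \<le> n' \<and>
     list_all (\<lambda>x. x \<noteq> 0) (take (d - d') (last A)) \<and>
     rows_indep (gram (map (drop (d - d')) (drop (length A - k') A)))"

lemma gram_append_zeros:
  assumes "\<forall>a \<in> set A. length a = r"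
  shows "gram (map (\<lambda>a. a @ replicate z 0) A) = gram A"
proof -
  have "hdot (xs @ replicate z 0) (ys @ replicate z 0) = hdot xs ys"
    if "length xs = length ys" for xs ys z
    using that
  proof (induction xs ys rule: list_induct2)
    case Nil
    show ?case by (induction z) auto
  qed simp
  moreover have "length (gram B ! i) = length B" if "i < length B" for B i
    using that length_gram_row by (metis length_gram nth_mem)
  ultimately show ?thesis
    using assms by (intro nth_equalityI) (simp_all add: nth_gram)
qed

text \<open>\<open>A1\<close> is shortened, \<open>A2\<close> also punctured, \<open>A3\<close>
  filled up with zero columns. The punctured symbols of the last row are nonzero, so its weight
  falls by exactly \<open>d - d'\<close> and it attains the new distance. The Gram matrix is tested
  for \<open>A2\<close>; zero columns do not change it.\<close>

lemma derivable_sound: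
  assumes dist: "min_dist_ge r A d" and sys: "systematic r d A"
    and der: "derivable r d A (n', k', d')"
  shows "lcd_params n' k' d'"
proof -
  define s p where "s = length A - k'" and "p = d - d'"
  define z where "z = n' - (k' + (r - p))"
  define A1 where "A1 = drop s A"
  define A2 where "A2 = map (drop p) A1"
  define A3 where "A3 = map (\<lambda>a. a @ replicate z 0) A2"
  have A: "\<forall>a \<in> set A. length a = r" "A \<noteq> []" "wt (last A) + 1 = d"
    using systematicD[OF sys] .
  have der': "0 < k'" "k' \<le> length A" "d' \<le> d" "p \<le> r" "k' + (r - p) \<le> n'"
    "\<forall>x \<in> set (take p (last A)). x \<noteq> 0" "rows_indep (gram A2)"
    using der by (auto simp: s_def p_def A1_def A2_def list_all_iff)
  have A1: "\<forall>a \<in> set A1. length a = r" "length A1 = k'" "min_dist_ge r A1 d"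
    using A der' min_dist_ge_drop_rows[OF dist A(1), of s]
    by (auto simp: A1_def s_def dest: in_set_dropD)
  have A2: "\<forall>a \<in> set A2. length a = r - p" "length A2 = k'" "min_dist_ge (r - p) A2 d'"
    using A1 min_dist_ge_drop_cols[OF A1(3,1) der'(4)] der'(3) by (auto simp: A2_def p_def)
  have A3: "\<forall>a \<in> set A3. length a = r - p + z" "length A3 = k'" "min_dist_ge (r - p + z) A3 d'"
    using A2 min_dist_ge_append_zeros[OF A2(3,1)] by (auto simp: A3_def)
  \<comment> \<open>As \<open>k'\<close> is positive, not all rows are dropped and the last one
    stays at the end.\<close>
  have "A1 ! (k' - 1) = last A"
    using A1 der' A(2) by (metis A1_def last_conv_nth last_drop length_greater_0_conv
        length_drop zero_less_diff)
  then have last: "A3 ! (k' - 1) = drop p (last A) @ replicate z 0"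
    using der'(1) A1(2) by (simp add: A3_def A2_def)
  have "wt (take p (last A)) = p"
    using der'(4,6) A by (simp add: wt_def)
  then have "wt (last A) = p + wt (drop p (last A))"
    by (metis append_take_drop_id wt_append)
  with last A(3) der'(3) have "wt (A3 ! (k' - 1)) + 1 = d'"
    by (simp add: p_def)
  moreover have "rows_indep (gram A3)"
    using der'(7) gram_append_zeros[OF A2(1)] by (simp add: A3_def)
  ultimately have "lcd_params (length A3 + (r - p + z)) (length A3) d'"
    using A3 der'(1) by (intro lcd_params_systematic[where i = "k' - 1"]) auto
  then show ?thesis
    using A3(2) der'(5) by (simp add: z_def)
qed

corollary lcd_params_derivable:
  assumes "min_dist_ge r A d" "systematic r d A" "list_all (derivable r d A) ts"
  shows "\<forall>(n, k, d) \<in> set ts. lcd_params n k d"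
  using derivable_sound[OF assms(1,2)] assms(3) by (auto simp: list_all_iff simp del: derivable.simps)

definition symbol :: "char \<Rightarrow> gf4" where
  "symbol c = (if c = CHR ''0'' then 0 else if c = CHR ''1'' then 1
     else if c = CHR ''2'' then Fw else Fw2)"

section \<open>The thirteen base codes\<close>

definition A_17_13_3 :: "gf4 list list" where
  "A_17_13_3 = map (map symbol)
    [''2312'', ''3002'', ''0320'', ''2212'', ''1103'', ''2310'', ''0302'', ''3103'', ''2211'',
     ''1001'', ''1200'', ''3032'', ''3010'']"

lemma systematic_17_13_3: "systematic 4 3 A_17_13_3"
  by code_simp

lemma low_weight_17_13_3: "low_weight 2 3 A_17_13_3"
  by code_simp

lemma min_dist_17_13_3: "min_dist_ge 4 A_17_13_3 3"
  using low_weight_17_13_3 systematic_17_13_3 by (rule min_dist_geI) code_simp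

lemma params_17_13_3: "\<forall>(n, k, d) \<in> set
    [(14, 10, 3), (15, 11, 3), (16, 12, 3), (17, 13, 3)]. lcd_params n k d"
  by (rule lcd_params_derivable[OF min_dist_17_13_3 systematic_17_13_3]) code_simp

definition A_30_23_5 :: "gf4 list list" where
  "A_30_23_5 = map (map symbol)
    [''1220021'', ''3212122'', ''0110312'', ''1311221'', ''2021030'', ''2113130'', ''1222323'',
     ''2110102'', ''2202112'', ''0202101'', ''2213231'', ''1232011'', ''2033021'', ''3001131'',
     ''3010222'', ''0033301'', ''2002033'', ''3133132'', ''1011111'', ''1213302'', ''0112113'',
     ''0121223'', ''3300303'']"

lemma systematic_30_23_5: "systematic 7 5 A_30_23_5"
  by code_simp

lemma low_weight_30_23_5: "low_weight 4 5 A_30_23_5"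
  by code_simp

lemma min_dist_30_23_5: "min_dist_ge 7 A_30_23_5 5"
  using low_weight_30_23_5 systematic_30_23_5 by (rule min_dist_geI) code_simp

lemma params_30_23_5: "\<forall>(n, k, d) \<in> set
    [(26, 19, 5), (26, 20, 4), (27, 19, 5), (27, 20, 5), (27, 21, 4), (28, 20, 5),
     (28, 21, 5), (28, 22, 4), (29, 21, 5), (29, 22, 5), (29, 23, 4), (30, 22, 5),
     (30, 23, 5)]. lcd_params n k d"
  by (rule lcd_params_derivable[OF min_dist_30_23_5 systematic_30_23_5]) code_simp

section \<open>Codes whose enumeration is shortened by an automorphism\<close>

definition A_30_21_6 :: "gf4 list list" where
  "A_30_21_6 = map (map symbol)
    [''120033030'', ''112203221'', ''021120022'', ''032010221'', ''133332112'', ''003013031'',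
     ''323222203'', ''233303020'', ''230333131'', ''100231130'', ''113231231'', ''312110010'',
     ''333130223'', ''130333220'', ''310202301'', ''120322001'', ''102033100'', ''023300310'',
     ''300013022'', ''010312201'', ''030100331'']"

lemma systematic_30_21_6: "systematic 9 6 A_30_21_6"
  by code_simp

lemma low_weight_30_21_6: "low_weight 4 6 A_30_21_6"
  by code_simp

text \<open>Four 7-cycles and two fixed check positions. No cycle contains more than 6 information
  positions, and \<open>6 * 5 < 7 * 5\<close>.\<close>

lemma averaging_30_21_6: "averaging 9 6 4 A_30_21_6
    [10, 6, 0, 24, 22, 4, 9, 2, 21, 27, 8, 19, 13, 1, 16, 18, 3, 7, 14, 20, 5, 17, 23, 11,
     25, 15, 12, 26, 28, 29]
    6 7"
  by code_simp

lemmas min_dist_30_21_6 =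
  min_dist_ge_averaging[OF low_weight_30_21_6 systematic_30_21_6 averaging_30_21_6]

lemma params_30_21_6: "\<forall>(n, k, d) \<in> set
    [(26, 17, 6), (27, 18, 6), (28, 19, 6), (29, 20, 6), (30, 21, 6), (27, 17, 6),
     (28, 18, 6), (30, 20, 6)]. lcd_params n k d"
  by (rule lcd_params_derivable[OF min_dist_30_21_6 systematic_30_21_6]) code_simp

definition A_30_19_7 :: "gf4 list list" where
  "A_30_19_7 = map (map symbol)
    [''20212012312'', ''03313010331'', ''30210233311'', ''21130303211'', ''11131330120'',
     ''12112032120'', ''00212312130'', ''33012210130'', ''33112113113'', ''00220303113'',
     ''21232003323'', ''32110010012'', ''23022113122'', ''01311331100'', ''10032023211'',
     ''12002202002'', ''32020331222'', ''33232232310'', ''12012120000'']"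

lemma systematic_30_19_7: "systematic 11 7 A_30_19_7"
  by code_simp

lemma low_weight_30_19_7: "low_weight 4 7 A_30_19_7"
  by code_simp

text \<open>Six 5-cycles with at most 4 information positions each;
  \<open>4 * 6 < 5 * 5\<close>.\<close>

lemma averaging_30_19_7: "averaging 11 7 4 A_30_19_7
    [12, 24, 6, 8, 28, 26, 11, 17, 1, 7, 5, 27, 10, 4, 19, 29, 2, 20, 22, 18, 21, 9, 23, 14,
     25, 3, 0, 16, 15, 13]
    4 5"
  by code_simp

lemmas min_dist_30_19_7 =
  min_dist_ge_averaging[OF low_weight_30_19_7 systematic_30_19_7 averaging_30_19_7]

lemma params_30_19_7: "\<forall>(n, k, d) \<in> set
    [(28, 17, 7), (29, 18, 7), (30, 19, 7), (26, 15, 7), (26, 16, 6), (27, 15, 7),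
     (27, 16, 7), (29, 17, 7), (29, 19, 6), (30, 18, 7)]. lcd_params n k d"
  by (rule lcd_params_derivable[OF min_dist_30_19_7 systematic_30_19_7]) code_simp

definition A_30_17_8 :: "gf4 list list" where
  "A_30_17_8 = map (map symbol)
    [''0022013313310'', ''3103322033120'', ''3220210331211'', ''3203001022223'', ''1103312102232'',
     ''2121220221003'', ''2203022131301'', ''0020323212130'', ''0131013232203'', ''0211131000322'',
     ''1110112330220'', ''1123120222301'', ''3300222213010'', ''3223103310113'', ''2211211301302'',
     ''3123222120200'', ''2310000120103'']"

lemma systematic_30_17_8: "systematic 13 8 A_30_17_8"
  by code_simp

lemma low_weight_30_17_8: "low_weight 4 8 A_30_17_8"
  by code_simp

text \<open>Three 9-cycles with at most 6 information positions each and three fixed check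
  positions; \<open>6 * 7 < 9 * 5\<close>.\<close>

lemma averaging_30_17_8: "averaging 13 8 4 A_30_17_8
    [24, 15, 10, 17, 18, 16, 9, 23, 12, 3, 26, 8, 0, 4, 13, 20, 6, 22, 19, 1, 21, 14, 7, 5,
     25, 2, 11, 27, 28, 29]
    6 9"
  by code_simp

lemmas min_dist_30_17_8 =
  min_dist_ge_averaging[OF low_weight_30_17_8 systematic_30_17_8 averaging_30_17_8]

lemma params_30_17_8: "\<forall>(n, k, d) \<in> set
    [(26, 14, 7), (27, 14, 8), (28, 15, 8), (28, 16, 7), (29, 16, 8), (30, 17, 8)]. lcd_params n k d"
  by (rule lcd_params_derivable[OF min_dist_30_17_8 systematic_30_17_8]) code_simp

definition A_30_16_9 :: "gf4 list list" where
  "A_30_16_9 = map (map symbol)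
    [''10023030131111'', ''33021231000013'', ''20213211120200'', ''12121111022010'',
     ''30103103311032'', ''13331302021132'', ''21030100121112'', ''23213023210310'',
     ''12212232223232'', ''22321100123000'', ''11233233023022'', ''10223312110223'',
     ''13001231321211'', ''31000321031010'', ''31300010212123'', ''30023302102010'']"

lemma systematic_30_16_9: "systematic 14 9 A_30_16_9"
  by code_simp

lemma low_weight_30_16_9: "low_weight 4 9 A_30_16_9"
  by code_simp

text \<open>Two 15-cycles with 7 and 9 information positions; \<open>9 * 8 < 15 * 5\<close>.\<close>

lemma averaging_30_16_9: "averaging 14 9 4 A_30_16_9
    [10, 16, 29, 28, 3, 27, 21, 12, 26, 6, 4, 9, 14, 1, 17, 11, 7, 18, 19, 20, 15, 13, 23,
     24, 25, 8, 5, 0, 2, 22]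
    9 15"
  by code_simp

lemmas min_dist_30_16_9 =
  min_dist_ge_averaging[OF low_weight_30_16_9 systematic_30_16_9 averaging_30_16_9]

lemma params_30_16_9: "\<forall>(n, k, d) \<in> set
    [(30, 16, 9), (26, 12, 9), (27, 13, 9), (28, 14, 9), (29, 15, 9)]. lcd_params n k d"
  by (rule lcd_params_derivable[OF min_dist_30_16_9 systematic_30_16_9]) code_simp

definition A_30_10_14 :: "gf4 list list" where
  "A_30_10_14 = map (map symbol)
    [''23112110311123311002'', ''21131111333220123102'', ''22033303011003011222'',
     ''10330211302210221203'', ''10300223230002212323'', ''12310231000033010122'',
     ''03211332120022011313'', ''01132313221132131322'', ''10220330011210010323'',
     ''11001010320331200311'']"

lemma systematic_30_10_14: "systematic 20 14 A_30_10_14"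
  by code_simp

lemma low_weight_30_10_14: "low_weight 4 14 A_30_10_14"
  by code_simp

text \<open>Two 15-cycles with 5 information positions each; 14 of the 15 powers already give
  \<open>5 * 13 < 14 * 5\<close>.\<close>

lemma averaging_30_10_14: "averaging 20 14 4 A_30_10_14
    [14, 12, 5, 8, 21, 15, 22, 25, 28, 10, 11, 1, 13, 0, 2, 16, 17, 18, 19, 9, 4, 6, 23, 24,
     7, 26, 27, 3, 29, 20]
    5 14"
  by code_simp

lemmas min_dist_30_10_14 =
  min_dist_ge_averaging[OF low_weight_30_10_14 systematic_30_10_14 averaging_30_10_14]

lemma params_30_10_14: "\<forall>(n, k, d) \<in> set
    [(27, 7, 14), (28, 7, 14), (28, 8, 14), (29, 8, 14), (29, 9, 14), (30, 9, 14),
     (30, 10, 14)]. lcd_params n k d"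
  by (rule lcd_params_derivable[OF min_dist_30_10_14 systematic_30_10_14]) code_simp

definition A_29_10_13 :: "gf4 list list" where
  "A_29_10_13 = map (map symbol)
    [''2333311131111333021'', ''1232213223002001123'', ''2132010023312103322'',
     ''0131013331211101031'', ''3013113232123312331'', ''3132320330101230131'',
     ''0111201020213223311'', ''1232030301023010021'', ''1321033123121232322'',
     ''3302000113110012301'']"

lemma systematic_29_10_13: "systematic 19 13 A_29_10_13"
  by code_simp

lemma low_weight_29_10_13: "low_weight 5 13 A_29_10_13"
  by code_simp

text \<open>Three 9-cycles with at most 4 information positions each and two fixed check positions.
  Information weight 5 is enumerated since \<open>4 * 12\<close> lies between \<open>9 * 5\<close>
  and \<open>9 * 6\<close>.\<close>

lemma averaging_29_10_13: "averaging 19 13 5 A_29_10_13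
    [12, 17, 7, 10, 5, 14, 21, 26, 2, 19, 15, 11, 13, 4, 3, 0, 1, 18, 9, 20, 6, 16, 23, 24,
     25, 8, 27, 22, 28]
    4 9"
  by code_simp

lemmas min_dist_29_10_13 =
  min_dist_ge_averaging[OF low_weight_29_10_13 systematic_29_10_13 averaging_29_10_13]

lemma params_29_10_13: "\<forall>(n, k, d) \<in> set
    [(26, 7, 13), (26, 8, 12), (27, 10, 11), (28, 10, 12), (29, 10, 13)]. lcd_params n k d"
  by (rule lcd_params_derivable[OF min_dist_29_10_13 systematic_29_10_13]) code_simp

section \<open>Codes of dimension at most 8, enumerated completely\<close>

definition A_30_8_15 :: "gf4 list list" where
  "A_30_8_15 = map (map symbol)
    [''3001103311101002133033'', ''0123101000303331310232'', ''0013111033010033021133'',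
     ''3323123202332201100000'', ''1022103111013133331020'', ''2130301322310101320313'',
     ''0321110331110103131311'', ''0000231101310310222130'']"

lemma systematic_30_8_15: "systematic 22 15 A_30_8_15"
  by code_simp

lemma low_weight_30_8_15: "low_weight 8 15 A_30_8_15"
  by code_simp

lemma min_dist_30_8_15: "min_dist_ge 22 A_30_8_15 15"
  using low_weight_30_8_15 systematic_30_8_15 by (rule min_dist_geI) code_simp

lemma params_30_8_15: "\<forall>(n, k, d) \<in> set
    [(29, 7, 15), (30, 8, 15)]. lcd_params n k d"
  by (rule lcd_params_derivable[OF min_dist_30_8_15 systematic_30_8_15]) code_simp

definition A_29_6_17 :: "gf4 list list" where
  "A_29_6_17 = map (map symbol)
    [''11313110330122320022330'', ''32130303020223021211130'', ''10112321301133123021020'',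
     ''11113310100311003213010'', ''33200231212223331302100'', ''31310100223202223310020'']"

lemma systematic_29_6_17: "systematic 23 17 A_29_6_17"
  by code_simp

lemma low_weight_29_6_17: "low_weight 6 17 A_29_6_17"
  by code_simp

lemma min_dist_29_6_17: "min_dist_ge 23 A_29_6_17 17"
  using low_weight_29_6_17 systematic_29_6_17 by (rule min_dist_geI) code_simp

lemma params_29_6_17: "\<forall>(n, k, d) \<in> set
    [(28, 5, 17), (29, 6, 17), (26, 6, 14), (30, 6, 17)]. lcd_params n k d"
  by (rule lcd_params_derivable[OF min_dist_29_6_17 systematic_29_6_17]) code_simp

definition A_30_5_19 :: "gf4 list list" where
  "A_30_5_19 = map (map symbol)
    [''1210111203213011302301232'', ''0331103323112301032121311'', ''3123100223013030211123112'',
     ''1132322330111332011200300'', ''2233003002013202311232303'']"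

lemma systematic_30_5_19: "systematic 25 19 A_30_5_19"
  by code_simp

lemma low_weight_30_5_19: "low_weight 5 19 A_30_5_19"
  by code_simp

lemma min_dist_30_5_19: "min_dist_ge 25 A_30_5_19 19"
  using low_weight_30_5_19 systematic_30_5_19 by (rule min_dist_geI) code_simp

lemma params_30_5_19: "\<forall>(n, k, d) \<in> set
    [(29, 5, 18), (30, 5, 19), (27, 4, 17)]. lcd_params n k d"
  by (rule lcd_params_derivable[OF min_dist_30_5_19 systematic_30_5_19]) code_simp

definition A_30_4_19 :: "gf4 list list" where
  "A_30_4_19 = map (map symbol)
    [''13322031321012323210033132'', ''33130121031130003212303120'', ''11213103202332031211103012'',
     ''32200000211303310232111011'']"

lemma systematic_30_4_19: "systematic 26 19 A_30_4_19"
  by code_simp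

lemma low_weight_30_4_19: "low_weight 4 19 A_30_4_19"
  by code_simp

lemma min_dist_30_4_19: "min_dist_ge 26 A_30_4_19 19"
  using low_weight_30_4_19 systematic_30_4_19 by (rule min_dist_geI) code_simp

lemma params_30_4_19: "\<forall>(n, k, d) \<in> set
    [(29, 4, 18), (30, 4, 19)]. lcd_params n k d"
  by (rule lcd_params_derivable[OF min_dist_30_4_19 systematic_30_4_19]) code_simp

definition A_26_4_17 :: "gf4 list list" where
  "A_26_4_17 = map (map symbol)
    [''0303122001302132112112'', ''2133312301121120220111'', ''3222130011133001231220'',
     ''2001132222032010113021'']"

lemma systematic_26_4_17: "systematic 22 17 A_26_4_17"
  by code_simp

lemma low_weight_26_4_17: "low_weight 4 17 A_26_4_17"
  by code_simp

lemma min_dist_26_4_17: "min_dist_ge 22 A_26_4_17 17"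
  using low_weight_26_4_17 systematic_26_4_17 by (rule min_dist_geI) code_simp

lemma params_26_4_17: "\<forall>(n, k, d) \<in> set
    [(26, 4, 17)]. lcd_params n k d"
  by (rule lcd_params_derivable[OF min_dist_26_4_17 systematic_26_4_17]) code_simp

theorem proposition5p2:
  shows "\<forall>(n :: nat, k :: nat, d :: nat) \<in>
    {(14,10,3), (15,11,3), (16,12,3), (17,13,3), (26,4,17), (26,17,6), (26,19,5), (26,20,4),
     (27,18,6), (27,19,5), (27,20,5), (27,21,4), (28,5,17), (28,17,7), (28,19,6), (28,20,5),
     (28,21,5), (28,22,4), (29,5,18), (29,6,17), (29,18,7), (29,20,6), (29,21,5), (29,22,5),
     (29,23,4), (30,5,19), (30,16,9), (30,19,7), (30,21,6), (30,22,5), (30,23,5)}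
    \<union>
    {(26,6,14), (26,7,13), (26,8,12), (26,12,9), (26,14,7), (26,15,7), (26,16,6), (27,4,17),
     (27,7,14), (27,10,11), (27,13,9), (27,14,8), (27,15,7), (27,16,7), (27,17,6), (28,7,14),
     (28,8,14), (28,10,12), (28,14,9), (28,15,8), (28,16,7), (28,18,6), (29,4,18), (29,7,15),
     (29,8,14), (29,9,14), (29,10,13), (29,15,9), (29,16,8), (29,17,7), (29,19,6), (30,4,19),
     (30,6,17), (30,8,15), (30,9,14), (30,10,14), (30,17,8), (30,18,7), (30,20,6)}.
    \<exists>C. quaternary_code_dist n k d C \<and> hermitian_LCD n C"
  unfolding lcd_params_def[symmetric]
  using params_17_13_3 params_30_23_5 params_30_21_6 params_30_19_7 params_30_17_8
    params_30_16_9 params_30_10_14 params_29_10_13 params_30_8_15 params_29_6_17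
    params_30_5_19 params_30_4_19 params_26_4_17
  by simp

end
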